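(* Let $G$ be a connected graph on $n$ vertices with Randić matrix $R$. If $$\operatorname{null}(R)\geq \frac{n^2+56n-141-28(n-3)\sqrt{2}}{15n-13},$$ then $$RE(G)\leq (n-3)\frac{\sqrt{2}}{2}+2.$$
   Context: Graphs are finite, simple and undirected. For a graph $G$ with vertex set $V$, edge set $E$ and vertex degrees $d_u$, the Randić matrix $R=[r_{uv}]$ is the real symmetric matrix indexed by $V$ with $r_{uv}=1/\sqrt{d_ud_v}$ if $uv\in E$ and $r_{uv}=0$ otherwise. The Randić energy is $RE(G)=\sum_{i=1}^n|\lambda_i|$, where $\lambda_1,\dots,\lambda_n$ are the eigenvalues of $R$ with multiplicity. $\operatorname{null}(R)$ denotes the dimension of the null space of $R$. *)

theory Defs
  imports
    Complex_Main
    "Graph_Theory.Digraph_Component"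
    "Jordan_Normal_Form.Char_Poly"
    "Jordan_Normal_Form.Matrix_Kernel"
begin

text \<open>
  A finite simple undirected graph is a \<open>pair_graph\<close>: a finite vertex set with a finite,
  irreflexive and symmetric set of arcs \<open>(u, v)\<close>. The edge \<open>uv\<close> is represented by the two
  arcs \<open>(u, v)\<close> and \<open>(v, u)\<close>, so the degree of \<open>u\<close> is its out-degree.
\<close>

definition degree_of :: "'a pair_pre_digraph \<Rightarrow> 'a \<Rightarrow> nat" where
  "degree_of G u = out_degree (with_proj G) u"

definition randic_entry :: "'a pair_pre_digraph \<Rightarrow> 'a \<Rightarrow> 'a \<Rightarrow> real" where
  "randic_entry G u v =
     (if (u, v) \<in> parcs G then 1 / sqrt (real (degree_of G u) * real (degree_of G v)) else 0)"

text \<open>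
  Matrices have rows and columns \<open>0, \<dots>, n - 1\<close>, so the vertices are listed as
  \<open>vs\<close>, with \<open>distinct vs\<close> and \<open>set vs = pverts G\<close>. Different listings give
  matrices that are conjugate by a permutation matrix.
\<close>

definition randic_mat :: "'a pair_pre_digraph \<Rightarrow> 'a list \<Rightarrow> real mat" where
  "randic_mat G vs =
     mat (length vs) (length vs) (\<lambda>(i, j). randic_entry G (vs ! i) (vs ! j))"

text \<open>
  The real eigenvalues with multiplicity are the real roots of the characteristic polynomial.
  The matrix is symmetric, so these are all the eigenvalues: see \<open>size_randic_spectrum\<close> below.
\<close>

definition randic_spectrum :: "'a pair_pre_digraph \<Rightarrow> 'a list \<Rightarrow> real multiset" where
  "randic_spectrum G vs = proots (char_poly (randic_mat G vs))"

definition randic_energy :: "'a pair_pre_digraph \<Rightarrow> 'a list \<Rightarrow> real" where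
  "randic_energy G vs = (\<Sum>x\<in>#randic_spectrum G vs. \<bar>x\<bar>)"

lemma randic_mat_carrier: "randic_mat G vs \<in> carrier_mat (length vs) (length vs)"
  by (simp add: randic_mat_def)

lemma randic_mat_symmetric:
  assumes "pair_graph G"
  shows "transpose_mat (randic_mat G vs) = randic_mat G vs"
proof -
  interpret pair_graph G by fact
  have "symmetric (with_proj G)" by (rule pair_sym_arcs)
  then have "(u, v) \<in> parcs G \<longleftrightarrow> (v, u) \<in> parcs G" for u v
    by (auto simp: symmetric_def sym_def arcs_ends_def arc_to_ends_def)
  then show ?thesis
    by (intro eq_matI) (auto simp: randic_mat_def randic_entry_def mult.commute)
qed

lemma symmetric_real_eigenvalue:
  fixes A :: "real mat"
  assumes A: "A \<in> carrier_mat n n" and sym: "transpose_mat A = A"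
    and ev: "eigenvalue (map_mat complex_of_real A) a"
  shows "a \<in> \<real>"
proof -
  let ?C = "map_mat complex_of_real A"
  have C: "?C \<in> carrier_mat n n" using A by simp
  have symC: "?C $$ (i, j) = ?C $$ (j, i)" if "i < n" "j < n" for i j
    using that A arg_cong[OF sym, of "\<lambda>M. M $$ (i, j)"] by simp
  obtain v where v: "v \<in> carrier_vec n" "v \<noteq> 0\<^sub>v n" "?C *\<^sub>v v = a \<cdot>\<^sub>v v"
    using ev A unfolding eigenvalue_def eigenvector_def by auto
  have av: "(\<Sum>j<n. ?C $$ (i, j) * v $ j) = a * v $ i" if "i < n" for i
  proof -
    have "(?C *\<^sub>v v) $ i = (\<Sum>j<n. ?C $$ (i, j) * v $ j)"
      using that C v(1) by (auto simp: scalar_prod_def lessThan_atLeast0 intro!: sum.cong)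
    then show ?thesis using v that by simp
  qed
  define N where "N = (\<Sum>i<n. v $ i * cnj (v $ i))"
  define Q where "Q = (\<Sum>i<n. \<Sum>j<n. ?C $$ (i, j) * v $ j * cnj (v $ i))"
  have "Q = (\<Sum>i<n. (\<Sum>j<n. ?C $$ (i, j) * v $ j) * cnj (v $ i))"
    by (simp add: Q_def sum_distrib_right)
  also have "\<dots> = a * N"
    by (simp add: av N_def sum_distrib_left mult.assoc)
  finally have Q: "Q = a * N" .
  have cnjC: "cnj (?C $$ (i, j)) = ?C $$ (i, j)" if "i < n" "j < n" for i j
    using that A by simp
  have "cnj Q = (\<Sum>i<n. \<Sum>j<n. ?C $$ (i, j) * cnj (v $ j) * v $ i)"
    unfolding Q_def by (simp add: cnjC del: index_map_mat)
  also have "\<dots> = (\<Sum>j<n. \<Sum>i<n. ?C $$ (i, j) * cnj (v $ j) * v $ i)"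
    by (rule sum.swap)
  also have "\<dots> = Q"
    unfolding Q_def using symC by (intro sum.cong refl) (simp add: mult_ac del: index_map_mat)
  finally have Q': "cnj Q = Q" .
  have N: "N = of_real (\<Sum>i<n. (cmod (v $ i))\<^sup>2)"
    unfolding N_def of_real_sum complex_norm_square ..
  obtain k where k: "k < n" "v $ k \<noteq> 0"
    using v(1,2) by (metis carrier_vecD eq_vecI index_zero_vec)
  have "(\<Sum>i<n. (cmod (v $ i))\<^sup>2) > 0"
    using k by (intro sum_pos2[of _ k]) auto
  then have "N \<noteq> 0" "cnj N = N" by (auto simp: N simp del: of_real_sum)
  then have "cnj a = a" using Q Q' by (metis complex_cnj_mult mult_right_cancel)
  then show ?thesis by (simp add: Reals_cnj_iff)
qed

lemma size_proots_char_poly_symmetric: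
  fixes A :: "real mat"
  assumes A: "A \<in> carrier_mat n n" and sym: "transpose_mat A = A"
  shows "size (proots (char_poly A)) = n"
proof -
  let ?C = "map_mat complex_of_real A"
  have C: "?C \<in> carrier_mat n n" using A by simp
  obtain as where as: "char_poly ?C = (\<Prod>a\<leftarrow>as. [:- a, 1:])" "length as = n"
    using char_poly_factorized[OF C] by auto
  have real: "complex_of_real (Re a) = a" if "a \<in> set as" for a
  proof -
    have "poly (char_poly ?C) a = 0"
      using that by (auto simp: as(1) poly_prod_list prod_list_zero_iff)
    then have "eigenvalue ?C a" using eigenvalue_root_char_poly[OF C] by simp
    then show ?thesis using symmetric_real_eigenvalue[OF A sym] by simp
  qed
  interpret h: map_poly_inj_comm_ring_hom complex_of_real ..
  have prod: "map_poly complex_of_real (\<Prod>r\<leftarrow>rs. [:- r, 1:])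
      = (\<Prod>r\<leftarrow>rs. [:- complex_of_real r, 1:])" for rs
  proof (induction rs)
    case (Cons r rs)
    have "map_poly complex_of_real ([:- r, 1:] * q)
        = [:- complex_of_real r, 1:] * map_poly complex_of_real q" for q
      by (subst h.hom_mult) (simp add: map_poly_pCons)
    with Cons show ?case by (simp only: list.map prod_list.Cons)
  qed simp
  have "map_poly complex_of_real (char_poly A) = char_poly ?C"
    by (rule of_real_hom.char_poly_hom[OF A, symmetric])
  also have "\<dots> = map_poly complex_of_real (\<Prod>r\<leftarrow>map Re as. [:- r, 1:])"
    unfolding as(1) prod using real by (simp add: o_def cong: map_cong)
  finally have eq: "char_poly A = (\<Prod>r\<leftarrow>map Re as. [:- r, 1:])"
    by (rule h.injectivity)
  have "size (proots (\<Prod>r\<leftarrow>rs. [:- r, 1:])) = length rs" for rs :: "real list"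
  proof (induction rs)
    case (Cons r rs)
    have nz: "(\<Prod>r\<leftarrow>rs. [:- r, 1:]) \<noteq> 0" by (auto simp: prod_list_zero_iff)
    show ?case using Cons nz by (simp only: list.map prod_list.Cons) (subst proots_mult, auto)
  qed simp
  then show ?thesis by (simp only: eq length_map as(2))
qed

lemma size_randic_spectrum:
  assumes "pair_graph G"
  shows "size (randic_spectrum G vs) = length vs"
  unfolding randic_spectrum_def
  by (rule size_proots_char_poly_symmetric[OF randic_mat_carrier randic_mat_symmetric[OF assms]])

end

theory Submission
  imports
    Defs
    "HOL-Analysis.Convex"
    "Jordan_Normal_Form.Jordan_Normal_Form_Uniqueness"
    "Jordan_Normal_Form.Jordan_Normal_Form_Existence"
begin

text \<open>
  All eigenvalues but one eigenvalue \<open>1\<close> and \<open>k\<close> eigenvalues \<open>0\<close>, where \<open>k\<close> is the nullity, are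
  estimated by the Cauchy-Schwarz inequality (\<open>sum_abs_minus_one_power2_le\<close>). With \<open>T\<close> the sum of
  the squares of all eigenvalues this gives
  \<open>(RE - 1)\<^sup>2 \<le> (n - 1 - k) * (T - 1)\<close>.
  The eigenvalue \<open>1\<close> belongs to the vector of the square roots of the degrees
  (\<open>one_in_randic_spectrum\<close>). Because the matrix is symmetric, \<open>T\<close> is the sum of its squared
  entries, and the eigenvalue \<open>0\<close> has multiplicity at least \<open>k\<close> (\<open>symmetric_proots_char_poly\<close>).
  Hence \<open>T\<close> is twice the sum of \<open>1 / (d u * d v)\<close> over the edges \<open>uv\<close>.

  The combinatorial core is the bound \<open>T \<le> 15 * (n + 1) / 28\<close> for connected graphs with at least
  three vertices (\<open>randic_square_sum_bound\<close>). It is a charging argument. The vertices are listed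
  from a root of degree at least two so that each later vertex has an earlier neighbour, and every
  edge is directed from its earlier end to its later end. An edge of weight \<open>56 / (d * e)\<close> is paid
  for by its two ends: its tail, of degree \<open>d\<close>, gives \<open>parent_share d\<close>, and its head, of degree
  \<open>e\<close>, gives \<open>child_share e\<close> (\<open>edge_paid\<close>). Every vertex except the root is the head of at least
  one edge, and then it spends at most 15 in total (\<open>vertex_budget\<close>); the root spends at most 30
  (\<open>root_budget\<close>). So the total weight, which is \<open>28 * T\<close>, is at most \<open>15 * n + 15\<close>.

  With this bound on \<open>T\<close>, the hypothesis on \<open>k\<close> says precisely that the right-hand side of the
  Cauchy-Schwarz estimate is at most the square of \<open>(n - 3) * sqrt 2 / 2 + 1\<close>. Graphs with one or
  two vertices are treated separately.
\<close>

section \<open>Sharing the weight of an edge between its ends\<close>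

text \<open>
  The weight of an edge is split between its two ends, one acting as parent and the other as
  child. The numbers are the solution of a recursion for trees. Let \<open>M d\<close> be the largest value
  of 56 times the sum of \<open>1 / (d u * d v)\<close> over the edges minus 15 times the number of vertices,
  over rooted branches whose root has degree \<open>d\<close> once joined to a parent; then \<open>M d\<close> is the maximum of
  \<open>- 15 + (d - 1) * (M e + 56 / (d * e))\<close> over the degree \<open>e\<close> of a child, with \<open>M 1 = - 15\<close>.
  The child share is \<open>- M d\<close> for \<open>d \<le> 4\<close> and is lowered to \<open>0\<close> for \<open>d > 4\<close>, where \<open>M d\<close> is negative. The parent share is
  what remains of a budget of 15 for each of the other \<open>d - 1\<close> edges, once one edge has been
  served as a child.
  For \<open>d = 1\<close> nothing remains and no edge is left; the value 41 makes the inequality for a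
  single edge hold with a leaf as parent as well.
\<close>

definition parent_share :: "nat \<Rightarrow> real" where
  "parent_share d = (if d = 1 then 41 else if d = 2 then 13 else if d = 3 then 22/3 else 15 / (real d - 1))"

definition child_share :: "nat \<Rightarrow> real" where
  "child_share d = (if d = 1 then 15 else if d = 2 then 2 else if d = 3 then 1/3 else 0)"

text \<open>
  Equality holds for the degrees \<open>(2, 1)\<close> and \<open>(4, 2)\<close>, parent first. Such edges make up the trees
  in which a hub of large degree is joined to centres of degree four, each carrying three pendent
  paths of length two; there the ratio of the total edge weight to the number of vertices tends to
  \<open>15\<close>, so the budget of 15 cannot be lowered.
\<close>

lemma edge_paid:
  assumes "d \<ge> 1" "e \<ge> 1"
  shows "56 / (real d * real e) \<le> parent_share d + child_share e"
proof -
  consider (a) "d < 4" "e < 4" | (b) "d < 4" "e \<ge> 4" | (c) "d \<ge> 4" "e < 4" | (d) "d \<ge> 4" "e \<ge> 4"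
    by linarith
  then show ?thesis
  proof cases
    case a
    then have "d \<in> {1,2,3}" "e \<in> {1,2,3}" using assms by auto
    then show ?thesis by (auto simp: parent_share_def child_share_def)
  next
    case b
    have "56 / (real d * real e) \<le> 56 / (real d * 4)"
      using assms b by (intro divide_left_mono mult_left_mono) auto
    moreover have "d \<in> {1,2,3}" using b assms by auto
    ultimately show ?thesis using b by (auto simp: parent_share_def child_share_def)
  next
    case c
    define x where "x = real d"
    have x: "x \<ge> 4" using c by (simp add: x_def)
    have "56 / x \<le> 15 / (x - 1) + 15"
    proof -
      have "0 \<le> 15 * (x - 28/15)\<^sup>2 + 56/15" by simp
      then show ?thesis using x by (simp add: field_simps power2_eq_square)
    qed
    moreover have "56 / (x * 2) \<le> 15 / (x - 1) + 2"
    proof -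
      \<comment> \<open>Tight at \<open>d = 4\<close>, the degree of the centres in the extremal trees.\<close>
      have "(x - 4) * (2 * x - 7) \<ge> 0" using x by (intro mult_nonneg_nonneg) auto
      then show ?thesis using x by (simp add: field_simps)
    qed
    moreover have "56 / (x * 3) \<le> 15 / (x - 1) + 1/3"
    proof -
      have "(x - 6)\<^sup>2 + 20 \<ge> 0" by simp
      then show ?thesis using x by (simp add: field_simps power2_eq_square)
    qed
    moreover have "e \<in> {1,2,3}" using c assms by auto
    ultimately show ?thesis using c by (auto simp: parent_share_def child_share_def x_def)
  next
    case d
    have "56 / (real d * real e) \<le> 56 / (real d * 4)"
      using d by (intro divide_left_mono mult_left_mono) auto
    also have "\<dots> \<le> 15 / (real d - 1)" using d by (simp add: field_simps)
    finally show ?thesis using d by (simp add: parent_share_def child_share_def)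
  qed
qed

text \<open>
  A vertex that is a child in \<open>i\<close> of its edges and a parent in the others stays within 15.
  For \<open>i = 1\<close> this is an equality by the choice of the parent share, and a further edge in which
  the vertex is a child costs no more than one in which it is a parent. This is why the shares,
  although derived from trees, also serve graphs with cycles.
\<close>

lemma vertex_budget:
  assumes "1 \<le> i" "i \<le> d"
  shows "real i * child_share d + (real d - real i) * parent_share d \<le> 15"
proof (cases "d < 4")
  case True
  then have "(d, i) \<in> {(1,1),(2,1),(2,2),(3,1),(3,2),(3,3)}" using assms by auto
  then show ?thesis by (auto simp: parent_share_def child_share_def)
next
  case False
  then show ?thesis using assms by (simp add: parent_share_def child_share_def field_simps)
qed

text \<open>
  The root is never a child, so it overspends; with degree at least two, by at most 15.
  This is the source of the additive constant in the final bound.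
\<close>

lemma root_budget: "d \<ge> 2 \<Longrightarrow> real d * parent_share d \<le> 30"
proof -
  assume "d \<ge> 2"
  then consider "d = 2" | "d = 3" | "d \<ge> 4" by linarith
  then show ?thesis by cases (simp_all add: parent_share_def field_simps)
qed

text \<open>
  The vertices are added one at a time, each next to a vertex already present, and every edge is
  directed from the earlier end to the later one. Every vertex except \<open>r\<close> is then a child at
  least once, so that \<open>vertex_budget\<close> applies to it. In a sum over ordered pairs every edge occurs
  twice, which turns the weight \<open>56 / (d u * d v)\<close> of an edge into \<open>28 / (d u * d v)\<close>.
\<close>

lemma arc_weight_bound:
  fixes V :: "'a set" and E :: "'a rel" and d :: "'a \<Rightarrow> nat"
  assumes "finite V" "sym E" "irrefl E"
    and deg: "\<And>u. u \<in> V \<Longrightarrow> real (d u) = (\<Sum>v\<in>V. of_bool ((u, v) \<in> E))"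
    and r: "r \<in> V" "d r \<ge> 2"
    and grow: "\<And>S. \<lbrakk>r \<in> S; S \<subset> V\<rbrakk> \<Longrightarrow> \<exists>x\<in>V - S. \<exists>u\<in>S. (u, x) \<in> E"
  shows "(\<Sum>u\<in>V. \<Sum>v\<in>V. of_bool ((u, v) \<in> E) * (28 / (real (d u) * real (d v)))) \<le> 15 * (real (card V) + 1)"
proof -
  define adj :: "'a \<Rightarrow> 'a \<Rightarrow> real" where "adj u v = of_bool ((u, v) \<in> E)" for u v
  define w where "w u v = 28 / (real (d u) * real (d v))" for u v
  \<comment> \<open>\<open>inner S + bd S\<close> grows by at most 15 per vertex: \<open>bd\<close> reserves the parent shares
    of the edges that leave \<open>S\<close>, whose outer ends will be added later.\<close>
  define inner where "inner S = (\<Sum>u\<in>S. \<Sum>v\<in>S. adj u v * w u v)" for S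
  define bd where "bd S = (\<Sum>u\<in>S. \<Sum>v\<in>V - S. adj u v * parent_share (d u))" for S
  have adj_sym: "adj u v = adj v u" for u v using \<open>sym E\<close> by (auto simp: adj_def sym_def)
  have adj_irrefl: "adj u u = 0" for u using \<open>irrefl E\<close> by (auto simp: adj_def irrefl_def)
  have deg': "real (d u) = (\<Sum>v\<in>V. adj u v)" if "u \<in> V" for u
    using deg[OF that] by (simp add: adj_def)
  have deg1: "d u \<ge> 1" if "u \<in> V" "v \<in> V" "(u, v) \<in> E" for u v
  proof -
    have "adj u v \<le> (\<Sum>v\<in>V. adj u v)" using that \<open>finite V\<close>
      by (intro member_le_sum) (auto simp: adj_def)
    then show ?thesis using deg'[OF that(1)] that by (simp add: adj_def)
  qed
  have step: "inner (insert x S) + bd (insert x S) \<le> inner S + bd S + 15"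
    if S: "S \<subseteq> V" and x: "x \<in> V" "x \<notin> S" and e: "u0 \<in> S" "(u0, x) \<in> E" for S x u0
  proof -
    have fin: "finite S" using S \<open>finite V\<close> by (rule finite_subset)
    \<comment> \<open>\<open>i\<close> counts the edges in which the new vertex is a child.\<close>
    define i where "i = card {u\<in>S. (x, u) \<in> E}"
    have i: "real i = (\<Sum>u\<in>S. adj x u)"
      using fin by (simp add: i_def adj_def Int_def sum.If_cases of_bool_def)
    have "u0 \<in> {u\<in>S. (x, u) \<in> E}" using e \<open>sym E\<close> by (auto simp: sym_def)
    then have "1 \<le> i" unfolding i_def using fin
      by (metis (no_types, lifting) One_nat_def Suc_leI card_gt_0_iff empty_iff finite_Collect_conjI finite_subset mem_Collect_eq subsetI)
    have VS: "V - S = insert x (V - insert x S)" using x by auto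
    have "(\<Sum>v\<in>V. adj x v) = (\<Sum>v\<in>S. adj x v) + (\<Sum>v\<in>V - S. adj x v)"
      using S \<open>finite V\<close> by (simp add: sum.subset_diff)
    also have "(\<Sum>v\<in>V - S. adj x v) = (\<Sum>v\<in>V - insert x S. adj x v)"
      using \<open>finite V\<close> by (subst VS) (simp add: adj_irrefl)
    finally have rest: "(\<Sum>v\<in>V - insert x S. adj x v) = real (d x) - real i"
      using deg'[OF x(1)] i by simp
    have "real (d x) - real i \<ge> 0" unfolding rest[symmetric] by (intro sum_nonneg) (simp add: adj_def)
    then have "i \<le> d x" by simp
    have w_sym: "w u v = w v u" for u v by (simp add: w_def mult.commute)
    have "inner (insert x S) = inner S + 2 * (\<Sum>u\<in>S. adj u x * w u x)"
      using fin x adj_sym w_sym unfolding inner_def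
      by (simp add: sum.distrib adj_irrefl algebra_simps)
    moreover have "bd S = (\<Sum>u\<in>S. \<Sum>v\<in>V - insert x S. adj u v * parent_share (d u))
        + (\<Sum>u\<in>S. adj u x * parent_share (d u))"
      unfolding bd_def using \<open>finite V\<close> by (subst VS) (simp add: sum.distrib algebra_simps)
    moreover have "bd (insert x S) = (\<Sum>u\<in>S. \<Sum>v\<in>V - insert x S. adj u v * parent_share (d u))
        + (real (d x) - real i) * parent_share (d x)"
      unfolding bd_def using fin x by (simp add: rest[symmetric] sum_distrib_right)
    moreover have "2 * (\<Sum>u\<in>S. adj u x * w u x) \<le> (\<Sum>u\<in>S. adj u x * (parent_share (d u) + child_share (d x)))"
      unfolding sum_distrib_left
    proof (rule sum_mono)
      fix u assume "u \<in> S"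
      show "2 * (adj u x * w u x) \<le> adj u x * (parent_share (d u) + child_share (d x))"
      proof (cases "(u, x) \<in> E")
        case True
        then have "(x, u) \<in> E" using \<open>sym E\<close> by (auto simp: sym_def)
        with True have "d u \<ge> 1" "d x \<ge> 1" using deg1 S x \<open>u \<in> S\<close> by blast+
        then show ?thesis using edge_paid[of "d u" "d x"] True by (simp add: adj_def w_def)
      qed (simp add: adj_def)
    qed
    moreover have "(\<Sum>u\<in>S. adj u x * (parent_share (d u) + child_share (d x)))
        = (\<Sum>u\<in>S. adj u x * parent_share (d u)) + real i * child_share (d x)"
      using i adj_sym by (simp add: distrib_left sum.distrib sum_distrib_right)
    ultimately show ?thesis using vertex_budget[OF \<open>1 \<le> i\<close> \<open>i \<le> d x\<close>] by linarith
  qed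
  have grown: "\<exists>S\<subseteq>V. r \<in> S \<and> card S = k + 1 \<and> inner S + bd S \<le> 15 * (real k + 1) + 15" if "k < card V" for k
    using that
  proof (induction k)
    case 0
    have "bd {r} = real (d r) * parent_share (d r)"
      using \<open>finite V\<close> r adj_irrefl deg'[OF r(1)]
      by (simp add: bd_def sum_distrib_right[symmetric] sum_diff1)
    moreover have "inner {r} = 0" by (simp add: inner_def adj_irrefl)
    ultimately show ?case using root_budget[OF r(2)] r by (intro exI[of _ "{r}"]) simp
  next
    case (Suc k)
    then obtain S where S: "S \<subseteq> V" "r \<in> S" "card S = k + 1" "inner S + bd S \<le> 15 * (real k + 1) + 15"
      by auto
    then have "S \<subset> V" using Suc.prems by auto
    with grow S(2) obtain x u where xu: "x \<in> V - S" "u \<in> S" "(u, x) \<in> E" by blast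
    have "finite S" using S(1) \<open>finite V\<close> by (rule finite_subset)
    then have "card (insert x S) = Suc k + 1" using S xu by simp
    moreover have "inner (insert x S) + bd (insert x S) \<le> 15 * (real (Suc k) + 1) + 15"
      using step[OF S(1) _ _ xu(2,3)] xu(1) S(4) by simp
    ultimately show ?case using S xu by (intro exI[of _ "insert x S"]) auto
  qed
  have "card V > 0" using r(1) \<open>finite V\<close> by (auto simp: card_gt_0_iff)
  with grown[of "card V - 1"] obtain S where S: "S \<subseteq> V" "card S = card V" "inner S + bd S \<le> 15 * real (card V) + 15"
    by (auto simp: of_nat_diff)
  then have "S = V" using \<open>finite V\<close> by (simp add: card_subset_eq)
  then show ?thesis using S(3) by (simp add: bd_def inner_def adj_def w_def)
qed

section \<open>Degrees and the sum of the squared entries of the Randic matrix\<close>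

lemma degree_of_eq_card:
  assumes "pair_graph G"
  shows "degree_of G u = card {v\<in>pverts G. (u, v) \<in> parcs G}"
proof -
  interpret pair_graph G by fact
  have "{e \<in> parcs G. fst e = u} = Pair u ` {v\<in>pverts G. (u, v) \<in> parcs G}"
    by (auto dest: in_arcsD2)
  then show ?thesis
    by (simp add: degree_of_def out_degree_def out_arcs_def card_image inj_on_def)
qed

lemma degree_of_eq_sum:
  assumes "pair_graph G"
  shows "real (degree_of G u) = (\<Sum>v\<in>pverts G. of_bool ((u, v) \<in> parcs G))"
proof -
  interpret pair_graph G by fact
  show ?thesis unfolding degree_of_eq_card[OF assms]
    using pair_finite_verts by (simp add: of_bool_def sum.If_cases Int_def)
qed

lemma parcs_sym_irrefl:
  assumes "pair_graph G"
  shows "sym (parcs G)" "irrefl (parcs G)"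
proof -
  interpret pair_graph G by fact
  show "sym (parcs G)" using pair_sym_arcs by (simp add: symmetric_def)
  show "irrefl (parcs G)" using pair_no_loops by (force simp: irrefl_def)
qed

text \<open>
  In this form connectedness orders the vertices so that each has an earlier neighbour, and makes
  all degrees positive.
\<close>

lemma connected_arc_leaving:
  assumes "pair_graph G" "Digraph_Component.connected (with_proj G)"
    and S: "S \<subset> pverts G" "S \<noteq> {}"
  shows "\<exists>x\<in>pverts G - S. \<exists>u\<in>S. (u, x) \<in> parcs G"
proof -
  interpret pair_graph G by fact
  obtain r y where r: "r \<in> S" and y: "y \<in> pverts G - S" using S by blast
  have "r \<rightarrow>\<^sup>*\<^bsub>with_proj (mk_symmetric (with_proj G))\<^esub> y"
    using assms(2) S r y by (auto simp: connected_def strongly_connected_def)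
  then have "(r, y) \<in> rtrancl_on (pverts G) (parcs G)"
    using reachable_mk_symmetric_eq[OF pair_sym_arcs] by (simp add: reachable_def)
  then have "y \<notin> S \<longrightarrow> ?thesis"
    using r by (induction rule: rtrancl_on_induct) auto
  then show ?thesis using y by blast
qed

lemma randic_entry_power2:
  "(randic_entry G u v)\<^sup>2
    = of_bool ((u, v) \<in> parcs G) * (1 / (real (degree_of G u) * real (degree_of G v)))"
  by (simp add: randic_entry_def power_divide)

text \<open>
  The left-hand side is twice the general Randic index with exponent \<open>-1\<close>, that is, twice the
  sum of \<open>1 / (d u * d v)\<close> over the edges. With at least three vertices some vertex has degree at
  least two and can serve as the root; the path with two vertices violates the bound.
\<close>

lemma randic_square_sum_bound:
  assumes G: "pair_graph G" "Digraph_Component.connected (with_proj G)"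
    and n: "card (pverts G) \<ge> 3"
  shows "(\<Sum>u\<in>pverts G. \<Sum>v\<in>pverts G. (randic_entry G u v)\<^sup>2) \<le> 15 * (real (card (pverts G)) + 1) / 28"
proof -
  interpret pair_graph G by fact
  note fin = pair_finite_verts
  obtain r0 where r0: "r0 \<in> pverts G" using n by (metis card.empty equals0I not_numeral_le_zero)
  have big: "\<not> pverts G \<subseteq> {a, b}" for a b
  proof
    assume "pverts G \<subseteq> {a, b}"
    then have "card (pverts G) \<le> card {a, b}" by (intro card_mono) auto
    also have "\<dots> \<le> 2" by (simp add: card_insert_if)
    finally show False using n by simp
  qed
  \<comment> \<open>Growing \<open>{r0}\<close> twice gives two edges with a common end \<open>u\<close>.\<close>
  have "{r0} \<subset> pverts G" using r0 big[of r0 r0] by auto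
  from connected_arc_leaving[OF G this]
  obtain x where x: "x \<in> pverts G" "x \<noteq> r0" "(r0, x) \<in> parcs G" by auto
  have "{r0, x} \<subset> pverts G" using r0 x big[of r0 x] by auto
  from connected_arc_leaving[OF G this]
  obtain y u where y: "y \<in> pverts G" "y \<notin> {r0, x}" "u \<in> {r0, x}" "(u, y) \<in> parcs G" by auto
  have xr: "(x, r0) \<in> parcs G" using x(3) parcs_sym_irrefl(1)[OF G(1)] by (auto simp: sym_def)
  define z where "z = (if u = r0 then x else r0)"
  have z: "z \<noteq> y" "z \<in> pverts G" "(u, z) \<in> parcs G"
    using xr x r0 y(2,3) by (auto simp: z_def)
  have u: "u \<in> pverts G" using y r0 x by auto
  have "card {y, z} \<le> degree_of G u"
    unfolding degree_of_eq_card[OF G(1)] using fin y z by (intro card_mono) auto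
  then have "degree_of G u \<ge> 2" using z by simp
  then have "(\<Sum>u\<in>pverts G. \<Sum>v\<in>pverts G. of_bool ((u, v) \<in> parcs G) *
      (28 / (real (degree_of G u) * real (degree_of G v)))) \<le> 15 * (real (card (pverts G)) + 1)"
    using connected_arc_leaving[OF G]
    by (intro arc_weight_bound[OF fin parcs_sym_irrefl[OF G(1)] degree_of_eq_sum[OF G(1)] u]) auto
  then have "28 * (\<Sum>u\<in>pverts G. \<Sum>v\<in>pverts G. (randic_entry G u v)\<^sup>2) \<le> 15 * (real (card (pverts G)) + 1)"
    by (simp add: randic_entry_power2 sum_distrib_left mult.left_commute mult.commute)
  then show ?thesis by simp
qed

section \<open>Eigenvalues of real symmetric matrices\<close>

lemma monic_eq_prod_proots:
  fixes p :: "'a :: idom poly"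
  assumes "size (proots p) = degree p" "lead_coeff p = 1"
  shows "p = (\<Prod>x\<in>#proots p. [:- x, 1:])"
  using assms
proof (induction "degree p" arbitrary: p)
  case 0
  then show ?case by (auto elim!: degree_eq_zeroE)
next
  case (Suc m)
  then obtain x where x: "x \<in># proots p" by (metis multiset_nonemptyE nat.distinct(1) size_empty)
  from Suc have "p \<noteq> 0" by auto
  with x have "poly p x = 0" by auto
  then obtain q where p: "p = [:- x, 1:] * q" by (auto simp: poly_eq_0_iff_dvd)
  with \<open>p \<noteq> 0\<close> have "q \<noteq> 0" by auto
  have pr: "proots p = add_mset x (proots q)"
    using proots_mult[of "[:- x, 1:]" q] \<open>q \<noteq> 0\<close> unfolding p by (simp del: mult_pCons_left)
  have deg: "degree p = Suc (degree q)" using \<open>q \<noteq> 0\<close> unfolding p by (subst degree_mult_eq) auto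
  have "lead_coeff q = 1" using Suc.prems(2) unfolding p lead_coeff_mult by simp
  with Suc.hyps(1)[of q] Suc.hyps(2) Suc.prems(1) pr deg
  have "q = (\<Prod>x\<in>#proots q. [:- x, 1:])" by simp
  then show ?case using p pr by simp
qed

definition mat_trace :: "'a :: comm_ring_1 mat \<Rightarrow> 'a" where
  "mat_trace A = (\<Sum>i<dim_row A. A $$ (i, i))"

lemma mat_mult_entry:
  assumes "A \<in> carrier_mat n m" "B \<in> carrier_mat m k" "i < n" "j < k"
  shows "(A * B) $$ (i, j) = (\<Sum>l<m. A $$ (i, l) * B $$ (l, j))"
  using assms by (auto simp: scalar_prod_def lessThan_atLeast0 intro!: sum.cong)

lemma mat_trace_mult_commute:
  assumes "A \<in> carrier_mat n m" "B \<in> carrier_mat m n"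
  shows "mat_trace (A * B) = mat_trace (B * A)"
proof -
  have "mat_trace (A * B) = (\<Sum>i<n. \<Sum>l<m. A $$ (i, l) * B $$ (l, i))"
    unfolding mat_trace_def using assms by (intro sum.cong) (auto simp: mat_mult_entry simp del: index_mult_mat(1))
  also have "\<dots> = (\<Sum>l<m. \<Sum>i<n. B $$ (l, i) * A $$ (i, l))"
    by (subst sum.swap) (simp add: mult.commute)
  also have "\<dots> = mat_trace (B * A)"
    unfolding mat_trace_def using assms by (intro sum.cong) (auto simp: mat_mult_entry simp del: index_mult_mat(1))
  finally show ?thesis .
qed

lemma mat_trace_similar:
  assumes A: "A \<in> carrier_mat n n" and sim: "similar_mat A B"
  shows "mat_trace A = mat_trace B"
proof -
  from sim obtain P Q where "similar_mat_wit A B P Q" unfolding similar_mat_def by blast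
  from similar_mat_witD2[OF A this]
  have B: "B \<in> carrier_mat n n" and P: "P \<in> carrier_mat n n" and Q: "Q \<in> carrier_mat n n"
    and AB: "A = P * B * Q" and QP: "Q * P = 1\<^sub>m n" by auto
  have "mat_trace A = mat_trace (Q * (P * B))"
    unfolding AB using B P Q by (intro mat_trace_mult_commute[of _ n n]) auto
  also have "Q * (P * B) = B" using B P Q QP by (simp flip: assoc_mult_mat)
  finally show ?thesis .
qed

text \<open>
  By Schur decomposition \<open>A\<close> is similar to a triangular matrix with the eigenvalues on the
  diagonal; the square of that matrix has the squares of the eigenvalues on its diagonal.
\<close>

lemma sum_list_power2_eq_trace_square:
  fixes A :: "'a :: conjugatable_ordered_field mat"
  assumes A: "A \<in> carrier_mat n n" and cp: "char_poly A = (\<Prod>e\<leftarrow>es. [:- e, 1:])"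
  shows "(\<Sum>e\<leftarrow>es. e\<^sup>2) = mat_trace (A * A)"
proof -
  obtain B P Q where B: "schur_decomposition A es = (B, P, Q)" by (metis prod_cases3)
  from schur_decomposition[OF A cp B]
  have wit: "similar_mat_wit A B P Q" and ut: "upper_triangular B" and diag: "diag_mat B = es" by auto
  have carB: "B \<in> carrier_mat n n" using similar_mat_witD2[OF A wit] by auto
  have "similar_mat (A * A) (B * B)"
    using similar_mat_wit_pow[OF wit, of 2] A carB unfolding similar_mat_def
    by (auto simp: numeral_2_eq_2)
  then have "mat_trace (A * A) = mat_trace (B * B)"
    using A by (intro mat_trace_similar[of _ n]) auto
  also have "\<dots> = (\<Sum>i<n. (B $$ (i, i))\<^sup>2)"
  proof -
    have "(B * B) $$ (i, i) = (B $$ (i, i))\<^sup>2" if "i < n" for i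
    proof -
      have "(B * B) $$ (i, i) = (\<Sum>l<n. B $$ (i, l) * B $$ (l, i))"
        by (rule mat_mult_entry[OF carB carB that that])
      also have "\<dots> = (\<Sum>l\<in>{i}. B $$ (i, l) * B $$ (l, i))"
      proof (intro sum.mono_neutral_right ballI)
        fix l assume "l \<in> {..<n} - {i}"
        then show "B $$ (i, l) * B $$ (l, i) = 0"
          using that ut carB by (cases "l < i") (auto simp: upper_triangular_def)
      qed (use that in auto)
      finally show ?thesis by (simp add: power2_eq_square)
    qed
    then show ?thesis using carB by (simp add: mat_trace_def)
  qed
  also have "\<dots> = (\<Sum>e\<leftarrow>es. e\<^sup>2)"
    unfolding diag[symmetric] diag_mat_def using carB
    by (simp add: o_def sum_list_sum_nth lessThan_atLeast0)
  finally show ?thesis by simp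
qed

text \<open>
  Geometric multiplicity is at most algebraic multiplicity: in the Jordan normal form each block
  for the eigenvalue \<open>0\<close> contributes one dimension to the kernel and its size to the order.
\<close>

lemma kernel_dim_le_order_char_poly:
  fixes A :: "'a :: conjugatable_ordered_field mat"
  assumes A: "A \<in> carrier_mat n n" and cp: "char_poly A = (\<Prod>e\<leftarrow>es. [:- e, 1:])"
  shows "kernel_dim A \<le> Polynomial.order 0 (char_poly A)"
proof -
  obtain n_as where jnf: "jordan_nf A n_as" using jordan_nf_exists[OF A cp] by blast
  have "char_matrix A 0 ^\<^sub>m 1 = A" using A by (intro eq_matI) (auto simp: char_matrix_def) 
  then have "kernel_dim A = dim_gen_eigenspace A 0 1" by (simp add: dim_gen_eigenspace_def)
  also have "\<dots> = (\<Sum>(n, e)\<leftarrow>[(n, e)\<leftarrow>n_as. e = 0]. min 1 n)"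
    unfolding dim_gen_eigenspace[OF jnf] by (simp add: o_def case_prod_unfold)
  also have "\<dots> \<le> (\<Sum>(n, e)\<leftarrow>[(n, e)\<leftarrow>n_as. e = 0]. n)"
    by (intro sum_list_mono) auto
  also have "\<dots> = Polynomial.order 0 (char_poly A)"
    unfolding jordan_nf_order[OF jnf] by (simp add: case_prod_unfold)
  finally show ?thesis .
qed

lemma symmetric_proots_char_poly:
  fixes A :: "real mat"
  assumes A: "A \<in> carrier_mat n n" and sym: "transpose_mat A = A"
  shows "(\<Sum>x\<in>#proots (char_poly A). x\<^sup>2) = (\<Sum>i<n. \<Sum>j<n. (A $$ (i, j))\<^sup>2)"
    and "kernel_dim A \<le> count (proots (char_poly A)) 0"
proof -
  obtain es where es: "proots (char_poly A) = mset es" by (metis ex_mset)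
  have "char_poly A = (\<Prod>x\<in>#mset es. [:- x, 1:])"
    unfolding es[symmetric]
    using size_proots_char_poly_symmetric[OF A sym] degree_monic_char_poly[OF A]
    by (intro monic_eq_prod_proots) auto
  then have cp: "char_poly A = (\<Prod>e\<leftarrow>es. [:- e, 1:])"
    by (simp add: prod_mset_prod_list flip: mset_map)
  have "(\<Sum>x\<in>#proots (char_poly A). x\<^sup>2) = (\<Sum>e\<leftarrow>es. e\<^sup>2)"
    by (simp add: es sum_mset_sum_list flip: mset_map)
  also have "\<dots> = mat_trace (A * A)" by (rule sum_list_power2_eq_trace_square[OF A cp])
  also have "\<dots> = (\<Sum>i<n. \<Sum>j<n. A $$ (i, j) * A $$ (j, i))"
    unfolding mat_trace_def using A
    by (intro sum.cong) (auto simp: mat_mult_entry[OF A A] simp del: index_mult_mat(1))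
  also have "\<dots> = (\<Sum>i<n. \<Sum>j<n. (A $$ (i, j))\<^sup>2)"
  proof (intro sum.cong refl)
    fix i j assume "i \<in> {..<n}" "j \<in> {..<n}"
    then have "A $$ (j, i) = A $$ (i, j)" using A arg_cong[OF sym, of "\<lambda>M. M $$ (i, j)"] by simp
    then show "A $$ (i, j) * A $$ (j, i) = (A $$ (i, j))\<^sup>2" by (simp add: power2_eq_square)
  qed
  finally show "(\<Sum>x\<in>#proots (char_poly A). x\<^sup>2) = (\<Sum>i<n. \<Sum>j<n. (A $$ (i, j))\<^sup>2)" .
  have "char_poly A \<noteq> 0" using degree_monic_char_poly[OF A] by auto
  with kernel_dim_le_order_char_poly[OF A cp]
  show "kernel_dim A \<le> count (proots (char_poly A)) 0" by simp
qed

lemma sum_mset_abs_power2_le: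
  fixes M :: "real multiset"
  shows "(\<Sum>x\<in>#M. \<bar>x\<bar>)\<^sup>2 \<le> real (size M) * (\<Sum>x\<in>#M. x\<^sup>2)"
proof -
  obtain xs where M: "M = mset xs" by (metis ex_mset)
  have "(\<Sum>i<length xs. \<bar>xs ! i\<bar>)\<^sup>2 \<le> (\<Sum>i<length xs. \<bar>xs ! i\<bar>\<^sup>2) * card {..<length xs}"
    by (rule sum_squared_le_sum_of_squares)
  then show ?thesis
    by (simp add: M sum_list_sum_nth lessThan_atLeast0 mult.commute sum_mset_sum_list flip: mset_map)
qed

text \<open>
  The Cauchy-Schwarz inequality is applied to what is left after removing one eigenvalue \<open>1\<close> and
  \<open>k\<close> eigenvalues \<open>0\<close>: the former enters both sums with the value \<open>1\<close>, and the latter only lower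
  the number of terms.
\<close>

lemma sum_abs_minus_one_power2_le:
  fixes M :: "real multiset"
  assumes one: "1 \<in># M" and k: "k \<le> count M 0"
  shows "k + 1 \<le> size M"
    and "((\<Sum>x\<in>#M. \<bar>x\<bar>) - 1)\<^sup>2 \<le> (real (size M) - 1 - real k) * ((\<Sum>x\<in>#M. x\<^sup>2) - 1)"
proof -
  define N where "N = M - {#1#} - replicate_mset k 0"
  have "replicate_mset k 0 \<subseteq># M - {#1#}"
    using k unfolding count_le_replicate_mset_subset_eq[symmetric] by simp
  then have "replicate_mset k 0 + N = M - {#1#}"
    unfolding N_def by (rule subset_mset.add_diff_inverse)
  then have M: "M = {#1#} + replicate_mset k 0 + N" using one by (simp add: insert_DiffM)
  show "k + 1 \<le> size M" by (subst M) simp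
  have "(\<Sum>x\<in>#M. \<bar>x\<bar>) = 1 + (\<Sum>x\<in>#N. \<bar>x\<bar>)" "(\<Sum>x\<in>#M. x\<^sup>2) = 1 + (\<Sum>x\<in>#N. x\<^sup>2)"
    "real (size M) = 1 + real k + real (size N)" by (subst M, simp)+
  with sum_mset_abs_power2_le[of N]
  show "((\<Sum>x\<in>#M. \<bar>x\<bar>) - 1)\<^sup>2 \<le> (real (size M) - 1 - real k) * ((\<Sum>x\<in>#M. x\<^sup>2) - 1)" by simp
qed

section \<open>The Randic spectrum and the energy bound\<close>

lemma sum_nth_set:
  assumes "distinct vs"
  shows "(\<Sum>i<length vs. f (vs ! i)) = (\<Sum>v\<in>set vs. f v)"
  using sum.reindex_bij_betw[OF bij_betw_nth[OF assms refl refl], of f] by simp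

text \<open>
  The vector of the square roots of the degrees is fixed by the Randic matrix, because the row of
  \<open>u\<close> applied to it has one term \<open>1 / sqrt (d u)\<close> for each of the \<open>d u\<close> neighbours of \<open>u\<close>.
\<close>

lemma one_in_randic_spectrum:
  assumes G: "pair_graph G" "Digraph_Component.connected (with_proj G)"
    and vs: "distinct vs" "set vs = pverts G" and n: "card (pverts G) \<ge> 2"
  shows "1 \<in># randic_spectrum G vs"
proof -
  interpret pair_graph G by fact
  note fin = pair_finite_verts
  let ?d = "\<lambda>u. real (degree_of G u)"
  have pos: "degree_of G u > 0" if "u \<in> pverts G" for u
  proof -
    have "{u} \<noteq> pverts G"
    proof
      assume "{u} = pverts G"
      from n this[symmetric] show False by simp
    qed
    with that have "{u} \<subset> pverts G" by auto
    from connected_arc_leaving[OF G this]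
    obtain x where "x \<in> pverts G" "(u, x) \<in> parcs G" by auto
    then show ?thesis unfolding degree_of_eq_card[OF G(1)] using fin by (auto simp: card_gt_0_iff)
  qed
  have row: "(\<Sum>v\<in>pverts G. randic_entry G u v * sqrt (?d v)) = sqrt (?d u)" if "u \<in> pverts G" for u
  proof -
    have "(\<Sum>v\<in>pverts G. randic_entry G u v * sqrt (?d v))
        = (\<Sum>v\<in>pverts G. of_bool ((u, v) \<in> parcs G) * (1 / sqrt (?d u)))"
      using pos by (intro sum.cong) (auto simp: randic_entry_def real_sqrt_mult)
    also have "\<dots> = ?d u * (1 / sqrt (?d u))"
      unfolding degree_of_eq_sum[OF G(1), of u] sum_distrib_right ..
    finally show ?thesis using pos[OF that] by (simp add: real_div_sqrt)
  qed
  let ?A = "randic_mat G vs"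
  define w where "w = vec (length vs) (\<lambda>i. sqrt (?d (vs ! i)))"
  have mem: "vs ! i \<in> pverts G" if "i < length vs" for i using nth_mem[OF that] vs(2) by simp
  have "?A *\<^sub>v w = 1 \<cdot>\<^sub>v w"
  proof (rule eq_vecI)
    fix i assume "i < dim_vec (1 \<cdot>\<^sub>v w)"
    then have i: "i < length vs" by (simp add: w_def)
    then have "(?A *\<^sub>v w) $ i = (\<Sum>j<length vs. randic_entry G (vs ! i) (vs ! j) * sqrt (?d (vs ! j)))"
      by (simp add: randic_mat_def w_def scalar_prod_def lessThan_atLeast0)
    also have "\<dots> = sqrt (?d (vs ! i))"
      using row[OF mem[OF i]] vs(2)
        sum_nth_set[OF vs(1), of "\<lambda>v. randic_entry G (vs ! i) v * sqrt (?d v)"] by simp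
    finally show "(?A *\<^sub>v w) $ i = (1 \<cdot>\<^sub>v w) $ i" using i by (simp add: w_def)
  qed (simp add: randic_mat_def w_def)
  moreover have "w \<noteq> 0\<^sub>v (length vs)"
  proof -
    have "0 < length vs" using vs n by (metis distinct_card not_numeral_le_zero neq0_conv)
    then have "w $ 0 > 0" using pos[OF mem] by (simp add: w_def)
    then show ?thesis using \<open>0 < length vs\<close> by auto
  qed
  ultimately have "eigenvalue ?A 1"
    unfolding eigenvalue_def eigenvector_def by (intro exI[of _ w]) (simp add: w_def randic_mat_def)
  then have "poly (char_poly ?A) 1 = 0" by (rule iffD1[OF eigenvalue_root_char_poly[OF randic_mat_carrier]])
  moreover have "char_poly ?A \<noteq> 0" using degree_monic_char_poly[OF randic_mat_carrier[of G vs]] by auto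
  ultimately show ?thesis by (simp add: randic_spectrum_def)
qed

theorem theorem4p5:
  fixes G :: "'a pair_pre_digraph" and vs :: "'a list" and n :: nat
  assumes "pair_graph G"
    and "Digraph_Component.connected (with_proj G)"
    and "distinct vs" and "set vs = pverts G"
    and "n = card (pverts G)"
    and "real (kernel_dim (randic_mat G vs))
       \<ge> ((real n)\<^sup>2 + 56 * real n - 141 - 28 * (real n - 3) * sqrt 2) / (15 * real n - 13)"
  shows "randic_energy G vs \<le> (real n - 3) * (sqrt 2 / 2) + 2"
proof -
  interpret pair_graph G by fact
  define k where "k = kernel_dim (randic_mat G vs)"
  define M where "M = randic_spectrum G vs"
  define T where "T = (\<Sum>u\<in>pverts G. \<Sum>v\<in>pverts G. (randic_entry G u v)\<^sup>2)"
  have len: "length vs = n" using assms(3,4,5) by (metis distinct_card)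
  have "pverts G \<noteq> {}" using assms(2) by (auto simp: connected_def strongly_connected_def)
  then have n1: "n \<ge> 1" using pair_finite_verts assms(5) by (simp add: Suc_le_eq card_gt_0_iff)
  have size: "size M = n" using size_randic_spectrum[OF assms(1)] len by (simp add: M_def)
  note spec = symmetric_proots_char_poly[OF randic_mat_carrier randic_mat_symmetric[OF assms(1)], of vs]
  have kc: "k \<le> count M 0" using spec(2) by (simp add: k_def M_def randic_spectrum_def)
  have "(\<Sum>x\<in>#M. x\<^sup>2) = (\<Sum>i<length vs. \<Sum>j<length vs. (randic_entry G (vs ! i) (vs ! j))\<^sup>2)"
    using spec(1) by (simp add: M_def randic_spectrum_def randic_mat_def)
  also have "\<dots> = (\<Sum>i<length vs. \<Sum>v\<in>pverts G. (randic_entry G (vs ! i) v)\<^sup>2)"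
    using sum_nth_set[OF assms(3), of "\<lambda>v. (randic_entry G (vs ! i) v)\<^sup>2" for i] assms(4) by simp
  also have "\<dots> = T"
    using sum_nth_set[OF assms(3), of "\<lambda>u. \<Sum>v\<in>pverts G. (randic_entry G u v)\<^sup>2"] assms(4)
    by (simp add: T_def)
  finally have sq: "(\<Sum>x\<in>#M. x\<^sup>2) = T" .
  have E: "randic_energy G vs = (\<Sum>x\<in>#M. \<bar>x\<bar>)" by (simp add: randic_energy_def M_def)
  have "sqrt 2 < (3/2 :: real)" by (rule real_less_lsqrt) (simp_all add: power2_eq_square)
  moreover have "(7/5 :: real) < sqrt 2" by (rule real_less_rsqrt) (simp add: power2_eq_square)
  ultimately have sqrt2: "sqrt 2 < 3/2" "7/5 < sqrt 2" by auto
  have den: "15 * real n - 13 > 0" using n1 by simp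
  have thr: "real k * (15 * real n - 13)
      \<ge> (real n)\<^sup>2 + 56 * real n - 141 - 28 * (real n - 3) * sqrt 2"
    using assms(6) den by (simp add: k_def pos_divide_le_eq)
  have one_in: "1 \<in># M" if "n \<ge> 2"
    unfolding M_def using one_in_randic_spectrum[OF assms(1-4)] that assms(5) by simp
  consider "n = 1" | "n = 2" | "n \<ge> 3" using n1 by linarith
  then show ?thesis
  proof cases
    case 1
    then obtain u where "pverts G = {u}" using assms(5) by (metis card_1_singletonE)
    then have "T = 0"
      using parcs_sym_irrefl(2)[OF assms(1)] by (simp add: T_def randic_entry_def irrefl_def)
    then have "(\<Sum>x\<in>#M. \<bar>x\<bar>)\<^sup>2 \<le> 0" using sum_mset_abs_power2_le[of M] sq by simp
    then show ?thesis using E 1 sqrt2 by simp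
  next
    case 2
    \<comment> \<open>The threshold is positive, so \<open>0\<close> is an eigenvalue; this excludes the single edge,
      whose energy exceeds the bound.\<close>
    have "k \<noteq> 0" using thr sqrt2 2 by auto
    from 2 have one: "1 \<in># M" using one_in by simp
    have "k + 1 \<le> 2" using sum_abs_minus_one_power2_le(1)[OF one kc] size 2 by simp
    with \<open>k \<noteq> 0\<close> have "k = 1" by simp
    then have "((\<Sum>x\<in>#M. \<bar>x\<bar>) - 1)\<^sup>2 \<le> 0" using sum_abs_minus_one_power2_le(2)[OF one kc] size 2 by simp
    then have "(\<Sum>x\<in>#M. \<bar>x\<bar>) = 1" by simp
    then show ?thesis using E 2 sqrt2 by simp
  next
    case 3
    then have one: "1 \<in># M" using one_in by simp
    have "real (size M) - 1 - real k \<ge> 0" using sum_abs_minus_one_power2_le(1)[OF one kc] by simp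
    have "T \<le> 15 * (real n + 1) / 28"
      unfolding T_def using randic_square_sum_bound[OF assms(1,2)] 3 assms(5) by simp
    then have T: "T - 1 \<le> (15 * real n - 13) / 28" by (simp add: field_simps)
    have "((\<Sum>x\<in>#M. \<bar>x\<bar>) - 1)\<^sup>2 \<le> (real n - 1 - real k) * (T - 1)"
      using sum_abs_minus_one_power2_le(2)[OF one kc] size sq by simp
    also have "\<dots> \<le> (real n - 1 - real k) * ((15 * real n - 13) / 28)"
      using T \<open>real (size M) - 1 - real k \<ge> 0\<close> size by (intro mult_left_mono) auto
    also have "\<dots> \<le> ((real n - 1) * (15 * real n - 13) - ((real n)\<^sup>2 + 56 * real n - 141 - 28 * (real n - 3) * sqrt 2)) / 28"
      using thr by (simp add: field_simps)
    \<comment> \<open>The threshold on \<open>k\<close> is the one for which a perfect square appears here.\<close>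
    also have "\<dots> = ((real n - 3) * (sqrt 2 / 2) + 1)\<^sup>2"
      by (simp add: field_simps power2_eq_square)
    finally have "(\<Sum>x\<in>#M. \<bar>x\<bar>) - 1 \<le> (real n - 3) * (sqrt 2 / 2) + 1"
      by (rule power2_le_imp_le) (use 3 in simp)
    then show ?thesis using E by simp
  qed
qed

end
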